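(* Let $(\rho_*,m_* )\in\mathbb{R}^2$ with $\rho_*>0$ and $p'(\rho_* )>m_*^2/\rho_*^2$, and for $\xi\in\mathbb{R}$ let $$S(\xi)=\begin{pmatrix}\alpha(\xi)&0\\0&1\end{pmatrix},\quad \widetilde A(\xi)=\begin{pmatrix}0&\alpha(\xi)\\ \alpha(\xi)&2m_*/\rho_*\end{pmatrix},\quad \widetilde B(\xi)=\xi^2\begin{pmatrix}0&0\\0&\mu\end{pmatrix},$$ with $\alpha(\xi)=p'(\rho_* )-m_*^2/\rho_*^2+\tfrac12k^2\xi^2$. Then the triplet $(S,\widetilde A,\widetilde B)$ is genuinely coupled. Moreover, the matrix symbol $\widetilde A(\xi)$ is of constant multiplicity in $\xi\in\mathbb{R}$.
   Context: Here $p(\rho)=\rho^\gamma$ with $\gamma>1$, and $\mu>0$, $k>0$ are constants. Genuine coupling: let $S,\widetilde A,\widetilde B\in C^\infty(\mathbb{R};\mathbb{R}^{2\times2})$ be symmetric for all $\xi$, with $S>0$ positive definite and $\widetilde B\ge0$ positive semi-definite. The triplet $(S,\widetilde A,\widetilde B)$ is genuinely coupled if for all $\xi\ne0$ every vector $V\in\ker\widetilde B(\xi)$, $V\ne0$, satisfies $(\varrho S(\xi)+\widetilde A(\xi))V\ne0$ for any $\varrho\in\mathbb{R}$. Constant multiplicity: all eigenvalues of $\widetilde A(\xi)$ are semi-simple and have constant multiplicity for all $\xi\in\mathbb{R}$. *)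

theory Defs
  imports "HOL-Analysis.Analysis"
begin

(* D n is the n-th derivative of f. *)
definition smooth :: "(real \<Rightarrow> 'a::real_normed_vector) \<Rightarrow> bool" where
  "smooth f \<longleftrightarrow> (\<exists>D. D 0 = f \<and>
     (\<forall>(n::nat) x. (D n has_vector_derivative D (Suc n) x) (at x)))"

definition symmetric_matrix :: "real^'n^'n \<Rightarrow> bool" where
  "symmetric_matrix M \<longleftrightarrow> transpose M = M"

definition positive_definite :: "real^'n^'n \<Rightarrow> bool" where
  "positive_definite M \<longleftrightarrow> (\<forall>v. v \<noteq> 0 \<longrightarrow> v \<bullet> (M *v v) > 0)"

definition positive_semidefinite :: "real^'n^'n \<Rightarrow> bool" where
  "positive_semidefinite M \<longleftrightarrow> (\<forall>v. v \<bullet> (M *v v) \<ge> 0)"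

definition matrix_kernel :: "'a::field^'n^'m \<Rightarrow> ('a^'n) set" where
  "matrix_kernel M = {v. M *v v = 0}"

(* The standing hypotheses on the three symbols (smoothness, symmetry, definiteness)
   are part of the predicate. *)
definition genuinely_coupled ::
  "(real \<Rightarrow> real^'n^'n) \<Rightarrow> (real \<Rightarrow> real^'n^'n) \<Rightarrow> (real \<Rightarrow> real^'n^'n) \<Rightarrow> bool" where
  "genuinely_coupled S A B \<longleftrightarrow>
     smooth S \<and> smooth A \<and> smooth B \<and>
     (\<forall>\<xi>. symmetric_matrix (S \<xi>) \<and> symmetric_matrix (A \<xi>) \<and> symmetric_matrix (B \<xi>)) \<and>
     (\<forall>\<xi>. positive_definite (S \<xi>)) \<and>
     (\<forall>\<xi>. positive_semidefinite (B \<xi>)) \<and>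
     (\<forall>\<xi>. \<xi> \<noteq> 0 \<longrightarrow>
        (\<forall>V \<in> matrix_kernel (B \<xi>). V \<noteq> 0 \<longrightarrow>
           (\<forall>r::real. (r *\<^sub>R S \<xi> + A \<xi>) *v V \<noteq> 0)))"

definition complexify :: "real^'n^'m \<Rightarrow> complex^'n^'m" where
  "complexify M = (\<chi> i j. complex_of_real (M $ i $ j))"

definition is_eigenvalue :: "'a::field^'n^'n \<Rightarrow> 'a \<Rightarrow> bool" where
  "is_eigenvalue M z \<longleftrightarrow> (\<exists>v. v \<noteq> 0 \<and> M *v v = z *s v)"

definition charpoly :: "'a::field^'n^'n \<Rightarrow> 'a poly" where
  "charpoly M = det (\<chi> i j. (if i = j then [:0, 1:] else 0) - [:M $ i $ j:])"

definition algebraic_multiplicity :: "'a::field^'n^'n \<Rightarrow> 'a \<Rightarrow> nat" where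
  "algebraic_multiplicity M z = order z (charpoly M)"

(* vec.dim is the dimension over the scalar field of the matrix, whereas plain dim
   would be the real dimension. *)
definition geometric_multiplicity :: "'a::field^'n^'n \<Rightarrow> 'a \<Rightarrow> nat" where
  "geometric_multiplicity M z = vec.dim (matrix_kernel (M - mat z))"

definition semisimple_eigenvalue :: "'a::field^'n^'n \<Rightarrow> 'a \<Rightarrow> bool" where
  "semisimple_eigenvalue M z \<longleftrightarrow>
     is_eigenvalue M z \<and> geometric_multiplicity M z = algebraic_multiplicity M z"

(* All (complex) eigenvalues are semisimple, and they form finitely many continuous
   branches l 0, ..., l (r - 1) that never meet and whose multiplicities m j do not
   depend on the parameter. *)
definition constant_multiplicity :: "(real \<Rightarrow> real^'n^'n) \<Rightarrow> bool" where
  "constant_multiplicity A \<longleftrightarrow>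
     (\<forall>\<xi> z. is_eigenvalue (complexify (A \<xi>)) z \<longrightarrow> semisimple_eigenvalue (complexify (A \<xi>)) z) \<and>
     (\<exists>(r::nat) (l :: nat \<Rightarrow> real \<Rightarrow> complex) (m :: nat \<Rightarrow> nat).
        (\<forall>j<r. continuous_on UNIV (l j)) \<and>
        (\<forall>\<xi>. inj_on (\<lambda>j. l j \<xi>) {..<r}) \<and>
        (\<forall>\<xi>. {z. is_eigenvalue (complexify (A \<xi>)) z} = (\<lambda>j. l j \<xi>) ` {..<r}) \<and>
        (\<forall>\<xi>. \<forall>j<r. algebraic_multiplicity (complexify (A \<xi>)) (l j \<xi>) = m j))"

definition pressure :: "real \<Rightarrow> real \<Rightarrow> real" where
  "pressure \<gamma> \<rho> = \<rho> powr \<gamma>"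

definition alpha :: "real \<Rightarrow> real \<Rightarrow> real \<Rightarrow> real \<Rightarrow> real \<Rightarrow> real" where
  "alpha \<gamma> k \<rho>s ms \<xi> =
     deriv (pressure \<gamma>) \<rho>s - ms\<^sup>2 / \<rho>s\<^sup>2 + 1/2 * k\<^sup>2 * \<xi>\<^sup>2"

definition S_sym :: "real \<Rightarrow> real \<Rightarrow> real \<Rightarrow> real \<Rightarrow> real \<Rightarrow> real^2^2" where
  "S_sym \<gamma> k \<rho>s ms \<xi> =
     vector [vector [alpha \<gamma> k \<rho>s ms \<xi>, 0],
             vector [0, 1]]"

definition A_sym :: "real \<Rightarrow> real \<Rightarrow> real \<Rightarrow> real \<Rightarrow> real \<Rightarrow> real^2^2" where
  "A_sym \<gamma> k \<rho>s ms \<xi> =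
     vector [vector [0, alpha \<gamma> k \<rho>s ms \<xi>],
             vector [alpha \<gamma> k \<rho>s ms \<xi>, 2 * ms / \<rho>s]]"

definition B_sym :: "real \<Rightarrow> real \<Rightarrow> real^2^2" where
  "B_sym \<mu> \<xi> =
     \<xi>\<^sup>2 *\<^sub>R vector [vector [0, 0],
                   vector [0, \<mu>]]"

end

theory Submission
  imports Defs
begin

text \<open>
  Since \<open>p'(\<rho>\<^sub>*) > m\<^sub>*\<^sup>2/\<rho>\<^sub>*\<^sup>2\<close>, the function \<open>\<alpha>\<close> is positive. This makes \<open>S(\<xi>)\<close> positive
  definite, and both claims then rest on \<open>\<alpha>(\<xi>) \<noteq> 0\<close>.

  \<^emph>\<open>Coupling.\<close> For \<open>\<xi> \<noteq> 0\<close> the kernel of \<open>B(\<xi>)\<close> is the first coordinate axis. As \<open>S(\<xi>)\<close> is diagonal,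
  the second component of \<open>(r S(\<xi>) + A(\<xi>)) (V\<^sub>1, 0)\<close> comes from the off-diagonal entry of \<open>A(\<xi>)\<close>
  alone: it is \<open>\<alpha>(\<xi>) V\<^sub>1\<close>, whatever \<open>r\<close> is. So it cannot vanish unless \<open>V\<close> does. The
  smoothness of the symbols holds because all three are polynomials of the form
  \<open>P + \<xi>\<^sup>2 Q\<close> (\<open>smooth_even_quadratic\<close>).

  \<^emph>\<open>Constant multiplicity.\<close> The characteristic polynomial of a real symmetric \<open>2 \<times> 2\<close> matrix with
  off-diagonal entry \<open>b\<close> has discriminant \<open>(a - d)\<^sup>2 + 4b\<^sup>2\<close>, which is positive once \<open>b \<noteq> 0\<close>. Hence
  the two eigenvalues are real and simple, and the quadratic formula presents them as two continuous
  branches that never meet (\<open>constant_multiplicity_symmetric_2x2\<close>).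
\<close>

section \<open>Smoothness of quadratic symbols\<close>

lemma smooth_even_quadratic:
  fixes P Q :: "'a::real_normed_vector"
  shows "smooth (\<lambda>x. P + x\<^sup>2 *\<^sub>R Q)"
proof -
  define D where "D n x = (if n = 0 then P + x\<^sup>2 *\<^sub>R Q else if n = 1 then (2 * x) *\<^sub>R Q
     else if n = 2 then 2 *\<^sub>R Q else 0)" for n :: nat and x :: real
  have "(D n has_vector_derivative D (Suc n) x) (at x)" for n x
  proof -
    consider "n = 0" | "n = 1" | "n = 2" | "n > 2"
      by linarith
    then show ?thesis
    proof cases
      case 1
      have "((\<lambda>x. P + x\<^sup>2 *\<^sub>R Q) has_vector_derivative (2 * x) *\<^sub>R Q) (at x)"
        by (auto intro!: derivative_eq_intros)
      with 1 show ?thesis by (simp add: D_def[abs_def])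
    next
      case 2
      have "((\<lambda>x. (2 * x) *\<^sub>R Q) has_vector_derivative 2 *\<^sub>R Q) (at x)"
        by (auto intro!: derivative_eq_intros)
      with 2 show ?thesis by (simp add: D_def[abs_def])
    qed (simp_all add: D_def[abs_def])
  qed
  moreover have "D 0 = (\<lambda>x. P + x\<^sup>2 *\<^sub>R Q)"
    by (simp add: D_def[abs_def])
  ultimately show ?thesis
    unfolding smooth_def by blast
qed

section \<open>Eigenvalues of two-by-two matrices\<close>

lemma matrix_kernel_2x2:
  fixes M :: "'a::field^2^2"
  shows "v \<in> matrix_kernel M \<longleftrightarrow>
    M$1$1 * v$1 + M$1$2 * v$2 = 0 \<and> M$2$1 * v$1 + M$2$2 * v$2 = 0"
  by (auto simp: matrix_kernel_def vec_eq_iff matrix_vector_mult_def sum_2 forall_2)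

lemma charpoly_2x2:
  fixes M :: "'a::field^2^2"
  shows "charpoly M = [:M$1$1 * M$2$2 - M$1$2 * M$2$1, - (M$1$1 + M$2$2), 1:]"
  by (simp add: charpoly_def det_2 algebra_simps)

lemma is_eigenvalue_iff_kernel:
  "is_eigenvalue M z \<longleftrightarrow> (\<exists>v \<in> matrix_kernel (M - mat z). v \<noteq> 0)"
proof -
  have "mat z *v v = z *s v" for v :: "'a^'b"
    by (simp add: vec_eq_iff matrix_vector_mult_def mat_def if_distrib if_distribR cong: if_cong)
  then show ?thesis
    by (auto simp: is_eigenvalue_def matrix_kernel_def matrix_vector_mult_diff_rdistrib)
qed

text \<open>As \<open>M\<^sub>1\<^sub>2 \<noteq> 0\<close>, the first row of \<open>M v = z v\<close> determines \<open>v\<^sub>2\<close> from \<open>v\<^sub>1\<close>, which confines the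
  eigenvectors to one line. On that line the second row reduces to the characteristic equation.\<close>

lemma eigenspace_2x2:
  fixes M :: "'a::field^2^2"
  assumes "M$1$2 \<noteq> 0" and "poly (charpoly M) z = 0"
  shows "matrix_kernel (M - mat z) = vec.span {vector [M$1$2, z - M$1$1]}"
proof (intro set_eqI iffI)
  fix v :: "'a^2" assume "v \<in> matrix_kernel (M - mat z)"
  then have "(M$1$1 - z) * v$1 + M$1$2 * v$2 = 0"
    by (simp add: matrix_kernel_2x2 mat_def)
  then have "v$2 = (v$1 / M$1$2) * (z - M$1$1)"
    using assms(1) by (simp add: field_simps add_eq_0_iff)
  then have "v = (v$1 / M$1$2) *s vector [M$1$2, z - M$1$1]"
    using assms(1) by (simp add: vec_eq_iff forall_2)
  then show "v \<in> vec.span {vector [M$1$2, z - M$1$1]}"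
    by (auto simp: vec.span_singleton)
next
  fix v :: "'a^2" assume "v \<in> vec.span {vector [M$1$2, z - M$1$1]}"
  then obtain c where v: "v = c *s vector [M$1$2, z - M$1$1]"
    by (auto simp: vec.span_singleton)
  have "M$2$1 * M$1$2 + (M$2$2 - z) * (z - M$1$1) = - poly (charpoly M) z"
    by (simp add: charpoly_2x2 algebra_simps)
  also have "\<dots> = 0"
    using assms(2) by simp
  finally have "c * (M$2$1 * M$1$2 + (M$2$2 - z) * (z - M$1$1)) = 0"
    by simp
  then show "v \<in> matrix_kernel (M - mat z)"
    by (simp add: matrix_kernel_2x2 mat_def v algebra_simps)
qed

lemma is_eigenvalue_2x2_iff:
  fixes M :: "'a::field^2^2"
  assumes "M$1$2 \<noteq> 0"
  shows "is_eigenvalue M z \<longleftrightarrow> poly (charpoly M) z = 0"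
proof
  assume "is_eigenvalue M z"
  then obtain v where "v \<noteq> 0" and v: "v \<in> matrix_kernel (M - mat z)"
    by (auto simp: is_eigenvalue_iff_kernel)
  have row1: "(M$1$1 - z) * v$1 + M$1$2 * v$2 = 0"
    and row2: "M$2$1 * v$1 + (M$2$2 - z) * v$2 = 0"
    using v by (simp_all add: matrix_kernel_2x2 mat_def)
  have "v$1 \<noteq> 0"
    using row1 assms \<open>v \<noteq> 0\<close> by (auto simp: vec_eq_iff forall_2)
  have "poly (charpoly M) z * v$1
      = (M$2$2 - z) * ((M$1$1 - z) * v$1 + M$1$2 * v$2)
        - M$1$2 * (M$2$1 * v$1 + (M$2$2 - z) * v$2)"
    by (simp add: charpoly_2x2 algebra_simps)
  also have "\<dots> = 0"
    by (simp add: row1 row2)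
  finally show "poly (charpoly M) z = 0"
    using \<open>v$1 \<noteq> 0\<close> by simp
next
  assume "poly (charpoly M) z = 0"
  then have "vector [M$1$2, z - M$1$1] \<in> matrix_kernel (M - mat z)"
    using assms by (simp add: eigenspace_2x2 vec.span_base)
  moreover have "(vector [M$1$2, z - M$1$1] :: 'a^2) \<noteq> 0"
    using assms by (auto simp: vec_eq_iff forall_2)
  ultimately show "is_eigenvalue M z"
    by (auto simp: is_eigenvalue_iff_kernel)
qed

lemma geometric_multiplicity_2x2:
  fixes M :: "'a::field^2^2"
  assumes "M$1$2 \<noteq> 0" and "is_eigenvalue M z"
  shows "geometric_multiplicity M z = 1"
proof -
  have "(vector [M$1$2, z - M$1$1] :: 'a^2) \<noteq> 0"
    using assms(1) by (auto simp: vec_eq_iff forall_2)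
  then show ?thesis
    using assms
    by (simp add: geometric_multiplicity_def eigenspace_2x2 is_eigenvalue_2x2_iff
        vec.dim_span vec.dim_singleton)
qed

lemma order_simple_root:
  fixes y z :: "'a::field"
  assumes "y \<noteq> z"
  shows "order y ([:-y, 1:] * [:-z, 1:]) = 1"
proof -
  have "order y ([:-y, 1:] * [:-z, 1:]) = order y [:-y, 1:] + order y [:-z, 1:]"
    by (rule order_mult) (simp add: no_zero_divisors)
  moreover have "order y [:-y, 1:] = 1"
    using order_power_n_n[of y 1] by simp
  moreover have "order y [:-z, 1:] = 0"
    using assms by (intro order_0I) simp
  ultimately show ?thesis
    by simp
qed

section \<open>Families of symmetric two-by-two matrices\<close>

text \<open>The branch with sign \<open>s = \<plusminus>1\<close> in the quadratic formula for the eigenvalues.\<close>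

definition eigenvalue_branch :: "real \<Rightarrow> real^2^2 \<Rightarrow> real" where
  "eigenvalue_branch s M =
     (M$1$1 + M$2$2 + s * sqrt ((M$1$1 - M$2$2)\<^sup>2 + 4 * (M$1$2)\<^sup>2)) / 2"

lemma charpoly_symmetric_2x2:
  fixes M :: "real^2^2"
  assumes "symmetric_matrix M"
  shows "charpoly (complexify M) =
    [:- complex_of_real (eigenvalue_branch (-1) M), 1:]
    * [:- complex_of_real (eigenvalue_branch 1 M), 1:]"
proof -
  define R where "R = sqrt ((M$1$1 - M$2$2)\<^sup>2 + 4 * (M$1$2)\<^sup>2)"
  have sym: "M$2$1 = M$1$2"
    using assms unfolding symmetric_matrix_def transpose_def vec_eq_iff by simp
  have R_sq: "R\<^sup>2 = (M$1$1 - M$2$2)\<^sup>2 + 4 * (M$1$2)\<^sup>2"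
    by (simp add: R_def)
  have branch: "eigenvalue_branch s M = (M$1$1 + M$2$2 + s * R) / 2" for s
    by (simp add: eigenvalue_branch_def R_def)
  have det: "M$1$1 * M$2$2 - M$1$2 * M$1$2 =
      eigenvalue_branch (-1) M * eigenvalue_branch 1 M"
    unfolding branch using R_sq by (simp add: field_simps power2_eq_square)
  have trace: "M$1$1 + M$2$2 = eigenvalue_branch (-1) M + eigenvalue_branch 1 M"
    by (simp add: eigenvalue_branch_def field_simps)
  have "charpoly (complexify M) =
      [:of_real (M$1$1 * M$2$2 - M$1$2 * M$1$2), - of_real (M$1$1 + M$2$2), 1:]"
    by (simp add: charpoly_2x2 complexify_def sym)
  also have "\<dots> = [:- of_real (eigenvalue_branch (-1) M), 1:]
      * [:- of_real (eigenvalue_branch 1 M), 1:]"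
    unfolding det trace by simp
  finally show ?thesis .
qed

text \<open>A nonzero off-diagonal entry makes the discriminant positive, so the two branches stay apart and
  every eigenvalue is a simple root; its eigenspace is a line by \<open>eigenspace_2x2\<close>, which makes it
  semisimple.\<close>

lemma constant_multiplicity_symmetric_2x2:
  fixes A :: "real \<Rightarrow> real^2^2"
  assumes cont: "continuous_on UNIV A"
    and sym: "\<And>\<xi>. symmetric_matrix (A \<xi>)"
    and off_diag: "\<And>\<xi>. A \<xi> $ 1 $ 2 \<noteq> 0"
  shows "constant_multiplicity A"
proof -
  define l :: "nat \<Rightarrow> real \<Rightarrow> complex"
    where "l j \<xi> = of_real (eigenvalue_branch (if j = 0 then -1 else 1) (A \<xi>))" for j \<xi>
  have cp: "charpoly (complexify (A \<xi>)) = [:- l 0 \<xi>, 1:] * [:- l 1 \<xi>, 1:]" for \<xi>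
    by (simp only: charpoly_symmetric_2x2[OF sym] l_def) simp
  have entry: "complexify (A \<xi>) $ 1 $ 2 \<noteq> 0" for \<xi>
    by (simp add: complexify_def off_diag)
  have distinct: "l 0 \<xi> \<noteq> l 1 \<xi>" for \<xi>
  proof -
    have "(A \<xi>$1$1 - A \<xi>$2$2)\<^sup>2 + 4 * (A \<xi>$1$2)\<^sup>2 > 0"
      using off_diag by (intro add_nonneg_pos) simp_all
    then show ?thesis
      by (simp add: l_def eigenvalue_branch_def)
  qed
  have eig: "is_eigenvalue (complexify (A \<xi>)) z \<longleftrightarrow> z = l 0 \<xi> \<or> z = l 1 \<xi>" for \<xi> z
    by (simp only: is_eigenvalue_2x2_iff[OF entry] cp poly_mult) auto
  have alg: "algebraic_multiplicity (complexify (A \<xi>)) z = 1"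
    if "z = l 0 \<xi> \<or> z = l 1 \<xi>" for \<xi> z
    using that order_simple_root[OF distinct[of \<xi>]]
      order_simple_root[OF distinct[of \<xi>, symmetric]]
    unfolding algebraic_multiplicity_def cp by (metis mult.commute)
  have cont_l: "continuous_on UNIV (l j)" for j
    unfolding l_def eigenvalue_branch_def by (intro continuous_intros cont) simp
  have two: "{..<2::nat} = {0, 1}"
    by auto
  show ?thesis
    unfolding constant_multiplicity_def
  proof (intro conjI)
    show "\<forall>\<xi> z. is_eigenvalue (complexify (A \<xi>)) z \<longrightarrow>
        semisimple_eigenvalue (complexify (A \<xi>)) z"
      using alg eig by (simp add: semisimple_eigenvalue_def geometric_multiplicity_2x2[OF entry])
    show "\<exists>(r::nat) (l :: nat \<Rightarrow> real \<Rightarrow> complex) (m :: nat \<Rightarrow> nat).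
        (\<forall>j<r. continuous_on UNIV (l j)) \<and>
        (\<forall>\<xi>. inj_on (\<lambda>j. l j \<xi>) {..<r}) \<and>
        (\<forall>\<xi>. {z. is_eigenvalue (complexify (A \<xi>)) z} = (\<lambda>j. l j \<xi>) ` {..<r}) \<and>
        (\<forall>\<xi>. \<forall>j<r. algebraic_multiplicity (complexify (A \<xi>)) (l j \<xi>) = m j)"
    proof (intro exI[of _ 2] exI[of _ l] exI[of _ "\<lambda>_. 1"] conjI allI impI)
      fix \<xi> j assume "j < (2::nat)"
      then have "j = 0 \<or> j = 1"
        by auto
      then show "algebraic_multiplicity (complexify (A \<xi>)) (l j \<xi>) = 1"
        by (intro alg) auto
    qed (use cont_l distinct eig in \<open>auto simp: two\<close>)
  qed
qed

section \<open>The three symbols\<close>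

lemma S_sym_eq:
  "S_sym \<gamma> k \<rho>s ms = (\<lambda>\<xi>. S_sym \<gamma> k \<rho>s ms 0 +
     \<xi>\<^sup>2 *\<^sub>R vector [vector [1/2 * k\<^sup>2, 0], vector [0, 0]])"
  by (simp add: fun_eq_iff vec_eq_iff forall_2 S_sym_def alpha_def)

lemma A_sym_eq:
  "A_sym \<gamma> k \<rho>s ms = (\<lambda>\<xi>. A_sym \<gamma> k \<rho>s ms 0 +
     \<xi>\<^sup>2 *\<^sub>R vector [vector [0, 1/2 * k\<^sup>2], vector [1/2 * k\<^sup>2, 0]])"
  by (simp add: fun_eq_iff vec_eq_iff forall_2 A_sym_def alpha_def)

lemma smooth_S_sym: "smooth (S_sym \<gamma> k \<rho>s ms)"
  by (subst S_sym_eq) (rule smooth_even_quadratic)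

lemma smooth_A_sym: "smooth (A_sym \<gamma> k \<rho>s ms)"
  by (subst A_sym_eq) (rule smooth_even_quadratic)

lemma smooth_B_sym: "smooth (B_sym \<mu>)"
  using smooth_even_quadratic[of 0 "vector [vector [0, 0], vector [0, \<mu>]] :: real^2^2"]
  by (simp add: B_sym_def[abs_def])

lemma alpha_pos:
  assumes "deriv (pressure \<gamma>) \<rho>s > ms\<^sup>2 / \<rho>s\<^sup>2"
  shows "alpha \<gamma> k \<rho>s ms \<xi> > 0"
  unfolding alpha_def using assms by (intro add_pos_nonneg) simp_all

lemma constant_multiplicity_A_sym:
  assumes "deriv (pressure \<gamma>) \<rho>s > ms\<^sup>2 / \<rho>s\<^sup>2"
  shows "constant_multiplicity (A_sym \<gamma> k \<rho>s ms)"
proof (rule constant_multiplicity_symmetric_2x2)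
  show "continuous_on UNIV (A_sym \<gamma> k \<rho>s ms)"
    by (subst A_sym_eq) (intro continuous_intros)
  show "symmetric_matrix (A_sym \<gamma> k \<rho>s ms \<xi>)" for \<xi>
    by (simp add: symmetric_matrix_def A_sym_def transpose_def vec_eq_iff forall_2)
  show "A_sym \<gamma> k \<rho>s ms \<xi> $ 1 $ 2 \<noteq> 0" for \<xi>
    using alpha_pos[OF assms, of k \<xi>] by (simp add: A_sym_def)
qed

lemma genuinely_coupled_symbols:
  assumes "\<mu> > 0" and "deriv (pressure \<gamma>) \<rho>s > ms\<^sup>2 / \<rho>s\<^sup>2"
  shows "genuinely_coupled (S_sym \<gamma> k \<rho>s ms) (A_sym \<gamma> k \<rho>s ms) (B_sym \<mu>)"
proof -
  note pos = alpha_pos[OF assms(2), of k]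
  have sym: "symmetric_matrix (S_sym \<gamma> k \<rho>s ms \<xi>)" "symmetric_matrix (A_sym \<gamma> k \<rho>s ms \<xi>)"
    "symmetric_matrix (B_sym \<mu> \<xi>)" for \<xi>
    by (simp_all add: symmetric_matrix_def S_sym_def A_sym_def B_sym_def transpose_def
        vec_eq_iff forall_2)
  have S_pos: "positive_definite (S_sym \<gamma> k \<rho>s ms \<xi>)" for \<xi>
    unfolding positive_definite_def
  proof (intro allI impI)
    fix v :: "real^2" assume "v \<noteq> 0"
    then have "v$1 \<noteq> 0 \<or> v$2 \<noteq> 0"
      by (auto simp: vec_eq_iff forall_2)
    then have "alpha \<gamma> k \<rho>s ms \<xi> * (v$1)\<^sup>2 + (v$2)\<^sup>2 > 0"
      using pos[of \<xi>] by (auto intro: add_pos_nonneg add_nonneg_pos)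
    then show "v \<bullet> (S_sym \<gamma> k \<rho>s ms \<xi> *v v) > 0"
      by (simp add: S_sym_def inner_vec_def matrix_vector_mult_def sum_2 power2_eq_square
          algebra_simps)
  qed
  have B_nonneg: "positive_semidefinite (B_sym \<mu> \<xi>)" for \<xi>
    unfolding positive_semidefinite_def
  proof
    fix v :: "real^2"
    have "v \<bullet> (B_sym \<mu> \<xi> *v v) = \<mu> * (\<xi> * v$2)\<^sup>2"
      by (simp add: B_sym_def inner_vec_def matrix_vector_mult_def sum_2 power2_eq_square)
    then show "v \<bullet> (B_sym \<mu> \<xi> *v v) \<ge> 0"
      using assms(1) by simp
  qed
  have coupling: "(r *\<^sub>R S_sym \<gamma> k \<rho>s ms \<xi> + A_sym \<gamma> k \<rho>s ms \<xi>) *v V \<noteq> 0"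
    if "\<xi> \<noteq> 0" "V \<in> matrix_kernel (B_sym \<mu> \<xi>)" "V \<noteq> 0" for \<xi> r V
  proof -
    have V2: "V$2 = 0"
      using that assms(1) by (simp add: matrix_kernel_2x2 B_sym_def)
    then have "V$1 \<noteq> 0"
      using \<open>V \<noteq> 0\<close> by (auto simp: vec_eq_iff forall_2)
    moreover have "((r *\<^sub>R S_sym \<gamma> k \<rho>s ms \<xi> + A_sym \<gamma> k \<rho>s ms \<xi>) *v V) $ 2
        = alpha \<gamma> k \<rho>s ms \<xi> * V$1"
      by (simp add: S_sym_def A_sym_def matrix_vector_mult_def sum_2 V2)
    ultimately show ?thesis
      using pos[of \<xi>] by (metis less_irrefl no_zero_divisors zero_index)
  qed
  show ?thesis
    unfolding genuinely_coupled_def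
    using smooth_S_sym smooth_A_sym smooth_B_sym sym S_pos B_nonneg coupling by blast
qed

theorem lemma8:
  fixes \<gamma> \<mu> k \<rho>s ms :: real
  assumes "\<gamma> > 1" and "\<mu> > 0" and "k > 0"
    and "\<rho>s > 0"
    and "deriv (pressure \<gamma>) \<rho>s > ms\<^sup>2 / \<rho>s\<^sup>2"
  shows "genuinely_coupled (S_sym \<gamma> k \<rho>s ms) (A_sym \<gamma> k \<rho>s ms) (B_sym \<mu>) \<and>
         constant_multiplicity (A_sym \<gamma> k \<rho>s ms)"
  using genuinely_coupled_symbols constant_multiplicity_A_sym assms by blast

end
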